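(* Let $N\ge 1$. The coefficient matrices $A_H(U)$ and $B_H(U)$ of the two-dimensional hyperbolic shallow water moment equations (HSWME) $\partial_tU+A_H(U)\partial_xU+B_H(U)\partial_yU=S(U)$ (defined in the context) satisfy the rotational invariance $$\cos\theta\,A_H(U)+\sin\theta\,B_H(U)=T(\theta)^{-1}A_H(T(\theta)U)\,T(\theta)$$ for every angle $0\le\theta<2\pi$ and every state $U$.
   Context: State vector: $U=(h,hu_m,hv_m,h\alpha_1,h\beta_1,\dots,h\alpha_N,h\beta_N)^T\in\mathbb{R}^{2N+3}$ with $h>0$; $g>0$ is a constant. $h,u_m,v_m,\alpha_i,\beta_i$ are regarded as functions of $U$. Let $\phi_j$ be the Legendre polynomial of degree $j$ shifted to $[0,1]$ (orthogonal on $[0,1]$) and normalized by $\phi_j(0)=1$. For $1\le i,j,k\le N$ put $A_{ijk}=(2i+1)\int_0^1\phi_i\phi_j\phi_k\,d\zeta$ and $B_{ijk}=(2i+1)\int_0^1\phi_i'(\zeta)\left(\int_0^\zeta\phi_j\,d\hat\zeta\right)\phi_k(\zeta)\,d\zeta$. The SWME matrices are $A(U)=\partial_UF(U)+P(U)$ and $B(U)=\partial_UG(U)+Q(U)$, where $\partial_U$ denotes the Jacobian. Fluxes: the components of $F(U)$, in the same order as those of $U$, are $hu_m$; $h(u_m^2+\sum_{j=1}^N\frac{\alpha_j^2}{2j+1})+\frac12gh^2$; $h(u_mv_m+\sum_{j=1}^N\frac{\alpha_j\beta_j}{2j+1})$; and, for $i=1,\dots,N$, the pair $h(2u_m\alpha_i+\sum_{j,k=1}^NA_{ijk}\alpha_j\alpha_k)$,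 $h(u_m\beta_i+v_m\alpha_i+\sum_{j,k=1}^NA_{ijk}\alpha_j\beta_k)$. The components of $G(U)$ are $hv_m$; $h(u_mv_m+\sum_j\frac{\alpha_j\beta_j}{2j+1})$; $h(v_m^2+\sum_j\frac{\beta_j^2}{2j+1})+\frac12gh^2$; and, for $i=1,\dots,N$, the pair $h(u_m\beta_i+v_m\alpha_i+\sum_{j,k}A_{ijk}\alpha_j\beta_k)$, $h(2v_m\beta_i+\sum_{j,k}A_{ijk}\beta_j\beta_k)$. Non-conservative parts: the first three rows and first three columns of $P(U)$ and $Q(U)$ vanish; the remaining $2N\times 2N$ parts consist of $2\times2$ blocks indexed by $1\le i,j\le N$ (block $i$ corresponding to $(h\alpha_i,h\beta_i)$), which are, with $\delta_{ij}$ the Kronecker delta, $$P_{ij}=\begin{pmatrix}-\delta_{ij}u_m+\sum_kB_{ijk}\alpha_k&0\\-\delta_{ij}v_m+\sum_kB_{ijk}\beta_k&0\end{pmatrix},\qquad Q_{ij}=\begin{pmatrix}0&-\delta_{ij}u_m+\sum_kB_{ijk}\alpha_k\\0&-\delta_{ij}v_m+\sum_kB_{ijk}\beta_k\end{pmatrix}.$$ HSWME matrices: $A_H(U)=A(h,hu_m,hv_m,h\alpha_1,h\beta_1,0,\dots,0)$ and $B_H(U)=B(h,hu_m,hv_m,h\alpha_1,h\beta_1,0,\dots,0)$, i.e. the SWME matrices evaluated with $\alpha_i=\beta_i=0$ for $2\le i\le N$. Rotation matrix: $T(\theta)=\mathrm{diag}(1,T_2(\theta),\dots,T_2(\theta))\in\mathbb{R}^{(2N+3)\times(2N+3)}$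 with $T_2(\theta)=\begin{pmatrix}\cos\theta&\sin\theta\\-\sin\theta&\cos\theta\end{pmatrix}$. *)

theory Defs
  imports
    "HOL-Analysis.Analysis"
    "HOL-Computational_Algebra.Polynomial"
    "Jordan_Normal_Form.Gauss_Jordan_Elimination"
begin

text \<open>
  State vectors and coefficient matrices have the size \<open>2 * N + 3\<close> for a variable number \<open>N\<close> of
  moments, so the vectors and matrices are those of the entry \<open>Jordan_Normal_Form\<close>, indexed
  from \<open>0\<close>: the entries \<open>0, 1, 2\<close> belong to \<open>h, h u_m, h v_m\<close>, and for \<open>1 \<le> i \<le> N\<close> the entries
  \<open>2 * i + 1\<close> and \<open>2 * i + 2\<close> belong to \<open>h \<alpha>_i\<close> and \<open>h \<beta>_i\<close>.
\<close>

no_notation vec_nth (infixl "$" 90)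

definition moment_vec :: "nat \<Rightarrow> real \<Rightarrow> real \<Rightarrow> real \<Rightarrow> (nat \<Rightarrow> real) \<Rightarrow> (nat \<Rightarrow> real) \<Rightarrow> real Matrix.vec" where
  "moment_vec N a b c p q = Matrix.vec (2 * N + 3) (\<lambda>r.
     if r = 0 then a else if r = 1 then b else if r = 2 then c
     else if odd r then p ((r - 1) div 2) else q ((r - 1) div 2))"

lemma moment_vec_index:
  "moment_vec N a b c p q $ 0 = a" "moment_vec N a b c p q $ 1 = b" "moment_vec N a b c p q $ 2 = c"
  "1 \<le> i \<Longrightarrow> i \<le> N \<Longrightarrow> moment_vec N a b c p q $ (2 * i + 1) = p i"
  "1 \<le> i \<Longrightarrow> i \<le> N \<Longrightarrow> moment_vec N a b c p q $ (2 * i + 2) = q i"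
  by (auto simp: moment_vec_def)


section \<open>Shifted Legendre polynomials and their triple integrals\<close>

text \<open>
  Rodrigues' formula on \<open>[0, 1]\<close>. The three lemmas after the definition show that this is the
  orthogonal family with the normalization \<open>1\<close> at \<open>0\<close>.
\<close>

definition shifted_legendre :: "nat \<Rightarrow> real poly" where
  "shifted_legendre j = Polynomial.smult (1 / fact j) ((pderiv ^^ j) ([:0, 1, -1:] ^ j))"

lemma poly_shifted_legendre_0: "poly (shifted_legendre j) 0 = 1"
proof -
  have e: "[:0, 1, -1:] ^ j = monom 1 j * [:1, -1:: real:] ^ j"
  proof -
    have "[:0, 1, -1:] = monom 1 1 * [:1, -1 :: real:]"
      by (simp add: monom_Suc)
    then show ?thesis
      by (metis monom_power mult.left_neutral power_mult_distrib power_one)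
  qed
  have "coeff ([:0, 1, -1:: real:] ^ j) j = coeff ([:1, -1 :: real:] ^ j) 0"
    unfolding e by (simp add: coeff_monom_mult)
  also have "\<dots> = 1"
    by (simp add: poly_0_coeff_0[symmetric])
  finally show ?thesis
    by (simp add: shifted_legendre_def poly_0_coeff_0 coeff_higher_pderiv pochhammer_fact[symmetric])
qed

lemma degree_shifted_legendre: "degree (shifted_legendre j) = j"
proof -
  have *: "degree ((pderiv ^^ k) p) = degree p - k" for k and p :: "real poly"
    by (induction k) (auto simp: degree_pderiv)
  show ?thesis
    by (simp add: shifted_legendre_def * degree_power_eq)
qed

lemma shifted_legendre_orthogonal:
  assumes "degree q < j"
  shows "((\<lambda>\<zeta>. poly (shifted_legendre j) \<zeta> * poly q \<zeta>) has_integral 0) {0..1}"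
proof -
  define w :: "real poly" where "w = [:0, 1, -1:]"
  have dvd: "w ^ (j - k) dvd (pderiv ^^ k) (w ^ j)" for k
  proof (induction k)
    case (Suc k)
    show ?case
    proof (cases "k < j")
      case True
      from Suc obtain r where r: "(pderiv ^^ k) (w ^ j) = w ^ Suc (j - Suc k) * r"
        using True by (metis Suc_diff_Suc dvdE)
      show ?thesis
        unfolding funpow.simps comp_apply r pderiv_mult pderiv_power_Suc
        by (intro dvd_add dvd_mult2[OF le_imp_power_dvd] dvd_mult[OF dvd_mult2[OF dvd_smult]]) auto
    qed simp
  qed simp
  have bd: "poly ((pderiv ^^ k) (w ^ j)) x = 0" if "k < j" "x \<in> {0, 1}" for k x
  proof -
    have "w dvd (pderiv ^^ k) (w ^ j)"
      using dvd[of k] that by (metis dvd_power dvd_trans zero_less_diff)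
    then obtain r where "(pderiv ^^ k) (w ^ j) = w * r" ..
    then show ?thesis
      using that by (auto simp: w_def)
  qed
  have main: "((\<lambda>\<zeta>. poly ((pderiv ^^ k) (w ^ j)) \<zeta> * poly q \<zeta>) has_integral 0) {0..1}"
    if "k \<le> j" "(pderiv ^^ k) q = 0" for k q
    using that
  proof (induction k arbitrary: q)
    case (Suc k)
    let ?f = "\<lambda>p. poly ((pderiv ^^ k) (w ^ j)) p"
    have IH: "((\<lambda>\<zeta>. ?f \<zeta> * poly (pderiv q) \<zeta>) has_integral 0) {0..1}"
      using Suc.prems by (intro Suc.IH) (auto simp: funpow_swap1)
    have "((\<lambda>\<zeta>. poly (pderiv ((pderiv ^^ k) (w ^ j) * q)) \<zeta>) has_integral
        poly ((pderiv ^^ k) (w ^ j) * q) 1 - poly ((pderiv ^^ k) (w ^ j) * q) 0) {0..1}"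
      by (rule fundamental_theorem_of_calculus)
         (auto intro!: poly_DERIV[THEN has_field_derivative_at_within]
           simp: has_real_derivative_iff_has_vector_derivative[symmetric] simp del: poly_mult)
    then have "((\<lambda>\<zeta>. poly (pderiv ((pderiv ^^ k) (w ^ j) * q)) \<zeta>) has_integral 0) {0..1}"
      using Suc.prems bd[of k] by simp
    from has_integral_diff[OF this IH] show ?case
      by (simp add: pderiv_mult algebra_simps)
  qed simp
  have "(pderiv ^^ k) q = 0" if "degree q < k" for k and q :: "real poly"
    using that by (intro poly_eqI) (simp add: coeff_higher_pderiv coeff_eq_0)
  from has_integral_mult_right[OF main[OF order.refl this[OF assms]], of "1 / fact j"] show ?thesis
    by (simp add: shifted_legendre_def w_def)
qed

definition A_coeff :: "nat \<Rightarrow> nat \<Rightarrow> nat \<Rightarrow> real" where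
  "A_coeff i j k = (2 * real i + 1) *
     integral {0..1} (\<lambda>\<zeta>. poly (shifted_legendre i) \<zeta> * poly (shifted_legendre j) \<zeta> * poly (shifted_legendre k) \<zeta>)"

definition B_coeff :: "nat \<Rightarrow> nat \<Rightarrow> nat \<Rightarrow> real" where
  "B_coeff i j k = (2 * real i + 1) *
     integral {0..1} (\<lambda>\<zeta>. poly (pderiv (shifted_legendre i)) \<zeta>
       * integral {0..\<zeta>} (poly (shifted_legendre j)) * poly (shifted_legendre k) \<zeta>)"


section \<open>Primitive variables as functions of the state\<close>

definition height :: "real Matrix.vec \<Rightarrow> real" where
  "height U = U $ 0"

definition u_mean :: "real Matrix.vec \<Rightarrow> real" where
  "u_mean U = U $ 1 / height U"

definition v_mean :: "real Matrix.vec \<Rightarrow> real" where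
  "v_mean U = U $ 2 / height U"

definition alpha :: "real Matrix.vec \<Rightarrow> nat \<Rightarrow> real" where
  "alpha U i = U $ (2 * i + 1) / height U"

definition beta :: "real Matrix.vec \<Rightarrow> nat \<Rightarrow> real" where
  "beta U i = U $ (2 * i + 2) / height U"


section \<open>Fluxes and Jacobians\<close>

definition flux_F :: "nat \<Rightarrow> real \<Rightarrow> real Matrix.vec \<Rightarrow> real Matrix.vec" where
  "flux_F N g U = (let h = height U; u = u_mean U; v = v_mean U; \<alpha> = alpha U; \<beta> = beta U in
     moment_vec N
       (h * u)
       (h * (u\<^sup>2 + (\<Sum>j=1..N. (\<alpha> j)\<^sup>2 / (2 * real j + 1))) + 1/2 * g * h\<^sup>2)
       (h * (u * v + (\<Sum>j=1..N. \<alpha> j * \<beta> j / (2 * real j + 1))))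
       (\<lambda>i. h * (2 * u * \<alpha> i + (\<Sum>j=1..N. \<Sum>k=1..N. A_coeff i j k * \<alpha> j * \<alpha> k)))
       (\<lambda>i. h * (u * \<beta> i + v * \<alpha> i + (\<Sum>j=1..N. \<Sum>k=1..N. A_coeff i j k * \<alpha> j * \<beta> k))))"

definition flux_G :: "nat \<Rightarrow> real \<Rightarrow> real Matrix.vec \<Rightarrow> real Matrix.vec" where
  "flux_G N g U = (let h = height U; u = u_mean U; v = v_mean U; \<alpha> = alpha U; \<beta> = beta U in
     moment_vec N
       (h * v)
       (h * (u * v + (\<Sum>j=1..N. \<alpha> j * \<beta> j / (2 * real j + 1))))
       (h * (v\<^sup>2 + (\<Sum>j=1..N. (\<beta> j)\<^sup>2 / (2 * real j + 1))) + 1/2 * g * h\<^sup>2)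
       (\<lambda>i. h * (u * \<beta> i + v * \<alpha> i + (\<Sum>j=1..N. \<Sum>k=1..N. A_coeff i j k * \<alpha> j * \<beta> k)))
       (\<lambda>i. h * (2 * v * \<beta> i + (\<Sum>j=1..N. \<Sum>k=1..N. A_coeff i j k * \<beta> j * \<beta> k))))"

text \<open>The entry \<open>(r, c)\<close> of the Jacobian is the partial derivative of component \<open>r\<close> in direction \<open>c\<close>.\<close>

definition jacobian :: "(real Matrix.vec \<Rightarrow> real Matrix.vec) \<Rightarrow> real Matrix.vec \<Rightarrow> real Matrix.mat" where
  "jacobian f U = Matrix.mat (dim_vec (f U)) (dim_vec U)
     (\<lambda>(r, c). deriv (\<lambda>t. f (U + t \<cdot>\<^sub>v unit_vec (dim_vec U) c) $ r) 0)"


section \<open>Non-conservative parts and coefficient matrices\<close>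

text \<open>
  For a row or column index \<open>r \<ge> 3\<close>, the block number is \<open>(r - 1) div 2\<close>, and \<open>r\<close> is the first
  index of its block iff it is odd.
\<close>

definition noncons_P :: "nat \<Rightarrow> real Matrix.vec \<Rightarrow> real Matrix.mat" where
  "noncons_P N U = Matrix.mat (2 * N + 3) (2 * N + 3) (\<lambda>(r, c).
     if r < 3 \<or> c < 3 then 0
     else let i = (r - 1) div 2; j = (c - 1) div 2; \<delta> = (if i = j then 1 else 0) in
       if odd c then
         (if odd r then - \<delta> * u_mean U + (\<Sum>k=1..N. B_coeff i j k * alpha U k)
          else - \<delta> * v_mean U + (\<Sum>k=1..N. B_coeff i j k * beta U k))
       else 0)"

definition noncons_Q :: "nat \<Rightarrow> real Matrix.vec \<Rightarrow> real Matrix.mat" where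
  "noncons_Q N U = Matrix.mat (2 * N + 3) (2 * N + 3) (\<lambda>(r, c).
     if r < 3 \<or> c < 3 then 0
     else let i = (r - 1) div 2; j = (c - 1) div 2; \<delta> = (if i = j then 1 else 0) in
       if odd c then 0
       else
         (if odd r then - \<delta> * u_mean U + (\<Sum>k=1..N. B_coeff i j k * alpha U k)
          else - \<delta> * v_mean U + (\<Sum>k=1..N. B_coeff i j k * beta U k)))"

definition SWME_A :: "nat \<Rightarrow> real \<Rightarrow> real Matrix.vec \<Rightarrow> real Matrix.mat" where
  "SWME_A N g U = jacobian (flux_F N g) U + noncons_P N U"

definition SWME_B :: "nat \<Rightarrow> real \<Rightarrow> real Matrix.vec \<Rightarrow> real Matrix.mat" where
  "SWME_B N g U = jacobian (flux_G N g) U + noncons_Q N U"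

text \<open>The state \<open>(h, h u_m, h v_m, h \<alpha>_1, h \<beta>_1, 0, \<dots>, 0)\<close>.\<close>

definition first_moment_state :: "nat \<Rightarrow> real Matrix.vec \<Rightarrow> real Matrix.vec" where
  "first_moment_state N U = Matrix.vec (2 * N + 3) (\<lambda>r. if r < 5 then U $ r else 0)"

definition HSWME_A :: "nat \<Rightarrow> real \<Rightarrow> real Matrix.vec \<Rightarrow> real Matrix.mat" where
  "HSWME_A N g U = SWME_A N g (first_moment_state N U)"

definition HSWME_B :: "nat \<Rightarrow> real \<Rightarrow> real Matrix.vec \<Rightarrow> real Matrix.mat" where
  "HSWME_B N g U = SWME_B N g (first_moment_state N U)"


section \<open>Rotation matrix\<close>

definition rot2 :: "real \<Rightarrow> real Matrix.mat" where
  "rot2 \<theta> = mat_of_rows_list 2 [[cos \<theta>, sin \<theta>], [- sin \<theta>, cos \<theta>]]"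

definition rotation :: "nat \<Rightarrow> real \<Rightarrow> real Matrix.mat" where
  "rotation N \<theta> = diag_block_mat (1\<^sub>m 1 # replicate (N + 1) (rot2 \<theta>))"

end

theory Submission
  imports Defs
begin

text \<open>The fluxes satisfy \<open>T (cos \<theta> F(U) + sin \<theta> G(U)) = F(T U)\<close>, since each block is built from the
  planar vectors \<open>(u, v)\<close> and \<open>(\<alpha>\<^sub>i, \<beta>\<^sub>i)\<close>. Differentiating this identity in every direction gives
  the claim for the Jacobians. For the non-conservative parts, \<open>cos \<theta> P + sin \<theta> Q\<close> consists of blocks
  that are a planar vector times the row \<open>(cos \<theta>, sin \<theta>)\<close>. So the identity holds for the full SWME
  matrices at any state of nonzero height, and it passes to the HSWME matrices because setting the
  higher moments to \<open>0\<close> commutes with \<open>T\<close>.\<close>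


section \<open>The rotation matrix\<close>

lemma rot2_carrier: "rot2 \<theta> \<in> carrier_mat 2 2"
  by (intro carrier_matI) (simp_all add: rot2_def mat_of_rows_list_def)

lemma rot2_index:
  "rot2 \<theta> $$ (0, 0) = cos \<theta>" "rot2 \<theta> $$ (0, Suc 0) = sin \<theta>"
  "rot2 \<theta> $$ (Suc 0, 0) = - sin \<theta>" "rot2 \<theta> $$ (Suc 0, Suc 0) = cos \<theta>"
  by (simp_all add: rot2_def mat_of_rows_list_def)

lemma diag_block_rot2_carrier:
  "diag_block_mat (replicate m (rot2 \<theta>)) \<in> carrier_mat (2 * m) (2 * m)"
proof (induction m)
  case (Suc m)
  then show ?case
    using rot2_carrier[of \<theta>] by (auto simp: Let_def)
qed simp

text \<open>Blocks start at even indices here. The induction peels off the first block, and the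
  shift by 2 keeps the parity.\<close>

lemma diag_block_rot2_index:
  assumes "r < 2 * m" "c < 2 * m"
  shows "diag_block_mat (replicate m (rot2 \<theta>)) $$ (r, c) =
    (if r = c then cos \<theta> else if even r \<and> c = Suc r then sin \<theta>
     else if even c \<and> r = Suc c then - sin \<theta> else 0)"
  using assms
proof (induction m arbitrary: r c)
  case (Suc m)
  have split: "r = 0 \<or> r = Suc 0 \<or> (\<exists>k. r = Suc (Suc k))" for r :: nat
    by (metis not0_implies_Suc)
  show ?case
    using Suc.prems split[of r] split[of c] rot2_carrier[of \<theta>] diag_block_rot2_carrier[of m \<theta>]
    by (elim disjE exE) (simp_all add: Let_def Suc.IH rot2_index)
qed simp

lemma rotation_carrier: "rotation N \<theta> \<in> carrier_mat (2 * N + 3) (2 * N + 3)"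
  using diag_block_rot2_carrier[of "N + 1" \<theta>]
  by (auto simp: rotation_def Let_def simp del: replicate_Suc)

text \<open>The leading entry 1 shifts the blocks by one, so they now start at odd indices.\<close>

lemma rotation_index:
  assumes "r < 2 * N + 3" "c < 2 * N + 3"
  shows "rotation N \<theta> $$ (r, c) =
    (if r = c then (if r = 0 then 1 else cos \<theta>) else if odd r \<and> c = Suc r then sin \<theta>
     else if odd c \<and> r = Suc c then - sin \<theta> else 0)"
  using assms diag_block_rot2_carrier[of "N + 1" \<theta>]
  by (cases r; cases c)
     (simp_all add: rotation_def Let_def diag_block_rot2_index del: replicate_Suc)

text \<open>Block \<open>i = 0\<close> is the momentum \<open>(h u\<^sub>m, h v\<^sub>m)\<close>, with which \<open>T\<close> deals as with the moments.\<close>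

lemma moment_index_cases:
  fixes r N :: nat
  assumes "r < 2 * N + 3"
  obtains "r = 0" | i where "i \<le> N" "r = 2 * i + 1" | i where "i \<le> N" "r = 2 * i + 2"
proof (cases "r = 0")
  case False
  show thesis
  proof (cases "odd r")
    case True
    then show ?thesis
      using that(2)[of "r div 2"] assms by simp
  next
    case even: False
    then show ?thesis
      using that(3)[of "r div 2 - 1"] assms False by auto
  qed
qed (use that in blast)

section \<open>Action of the rotation on vectors, and on matrices from the right\<close>

lemma rotation_mult_vec_index:
  assumes "x \<in> carrier_vec (2 * N + 3)"
  shows "(rotation N \<theta> *\<^sub>v x) $ 0 = x $ 0"
    and "i \<le> N \<Longrightarrow> (rotation N \<theta> *\<^sub>v x) $ (2 * i + 1) = cos \<theta> * x $ (2 * i + 1) + sin \<theta> * x $ (2 * i + 2)"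
    and "i \<le> N \<Longrightarrow> (rotation N \<theta> *\<^sub>v x) $ (2 * i + 2) = - sin \<theta> * x $ (2 * i + 1) + cos \<theta> * x $ (2 * i + 2)"
proof -
  let ?n = "2 * N + 3"
  have *: "(rotation N \<theta> *\<^sub>v x) $ r = (\<Sum>c<?n. rotation N \<theta> $$ (r, c) * x $ c)" if "r < ?n" for r
    using assms that rotation_carrier[of N \<theta>]
    by (auto simp: scalar_prod_def atLeast0LessThan intro!: sum.cong)
  \<comment> \<open>A row of T has at most two nonzero entries, so each of these sums collapses to
    indicator terms.\<close>
  have "(\<Sum>c<?n. rotation N \<theta> $$ (0, c) * x $ c) = (\<Sum>c<?n. if c = 0 then x $ 0 else 0)"
    by (intro sum.cong) (auto simp: rotation_index)
  then show "(rotation N \<theta> *\<^sub>v x) $ 0 = x $ 0"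
    by (simp add: *)
  assume i: "i \<le> N"
  have "(\<Sum>c<?n. rotation N \<theta> $$ (2 * i + 1, c) * x $ c) =
    (\<Sum>c<?n. (if c = 2 * i + 1 then cos \<theta> * x $ (2 * i + 1) else 0) +
      (if c = 2 * i + 2 then sin \<theta> * x $ (2 * i + 2) else 0))"
    using i by (intro sum.cong) (auto simp: rotation_index)
  then show "(rotation N \<theta> *\<^sub>v x) $ (2 * i + 1) = cos \<theta> * x $ (2 * i + 1) + sin \<theta> * x $ (2 * i + 2)"
    using i by (subst *) (auto simp: sum.distrib)
  have "(\<Sum>c<?n. rotation N \<theta> $$ (2 * i + 2, c) * x $ c) =
    (\<Sum>c<?n. (if c = 2 * i + 1 then - sin \<theta> * x $ (2 * i + 1) else 0) +
      (if c = 2 * i + 2 then cos \<theta> * x $ (2 * i + 2) else 0))"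
    using i by (intro sum.cong) (auto simp: rotation_index)
  then show "(rotation N \<theta> *\<^sub>v x) $ (2 * i + 2) = - sin \<theta> * x $ (2 * i + 1) + cos \<theta> * x $ (2 * i + 2)"
    using i by (subst *) (auto simp: sum.distrib)
qed

lemma transpose_rotation: "transpose_mat (rotation N \<theta>) = rotation N (- \<theta>)"
  by (rule eq_matI) (use rotation_carrier[of N \<theta>] rotation_carrier[of N "- \<theta>"] in \<open>auto simp: rotation_index\<close>)

lemma mult_rotation_index:
  assumes M: "M \<in> carrier_mat n (2 * N + 3)" and r: "r < n"
  shows "(M * rotation N \<theta>) $$ (r, 0) = M $$ (r, 0)"
    and "i \<le> N \<Longrightarrow> (M * rotation N \<theta>) $$ (r, 2 * i + 1) =
      cos \<theta> * M $$ (r, 2 * i + 1) - sin \<theta> * M $$ (r, 2 * i + 2)"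
    and "i \<le> N \<Longrightarrow> (M * rotation N \<theta>) $$ (r, 2 * i + 2) =
      sin \<theta> * M $$ (r, 2 * i + 1) + cos \<theta> * M $$ (r, 2 * i + 2)"
proof -
  \<comment> \<open>Row r of M T is the transpose of T applied to row r of M, so the vector formulas
    apply with \<theta> negated.\<close>
  have *: "(M * rotation N \<theta>) $$ (r, c) = (rotation N (- \<theta>) *\<^sub>v row M r) $ c" if "c < 2 * N + 3" for c
    using M r that rotation_carrier[of N \<theta>] rotation_carrier[of N "- \<theta>"]
    by (auto simp flip: transpose_rotation intro!: comm_scalar_prod[of _ "2 * N + 3"])
  have row: "row M r \<in> carrier_vec (2 * N + 3)" "\<And>c. c < 2 * N + 3 \<Longrightarrow> row M r $ c = M $$ (r, c)"
    using M r by auto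
  show "(M * rotation N \<theta>) $$ (r, 0) = M $$ (r, 0)"
    by (subst *) (auto simp: row rotation_mult_vec_index(1)[OF row(1)])
  assume i: "i \<le> N"
  show "(M * rotation N \<theta>) $$ (r, 2 * i + 1) = cos \<theta> * M $$ (r, 2 * i + 1) - sin \<theta> * M $$ (r, 2 * i + 2)"
    by (subst *; (subst rotation_mult_vec_index[OF row(1)])?) (use i in \<open>simp_all add: row(2)\<close>)
  show "(M * rotation N \<theta>) $$ (r, 2 * i + 2) = sin \<theta> * M $$ (r, 2 * i + 1) + cos \<theta> * M $$ (r, 2 * i + 2)"
    by (subst *; (subst rotation_mult_vec_index[OF row(1)])?) (use i in \<open>simp_all add: row(2)\<close>)
qed

section \<open>Inverse of the rotation matrix\<close>

lemma rotation_inverse: "rotation N (- \<theta>) * rotation N \<theta> = 1\<^sub>m (2 * N + 3)"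
proof (rule eq_matI)
  fix r c
  assume "r < dim_row (1\<^sub>m (2 * N + 3))" "c < dim_col (1\<^sub>m (2 * N + 3))"
  then have rc: "r < 2 * N + 3" "c < 2 * N + 3"
    by auto
  \<comment> \<open>The two diagonal positions of a block produce the Pythagorean identity with its
    summands in opposite orders.\<close>
  have cs: "cos \<theta> * cos \<theta> + sin \<theta> * sin \<theta> = 1" "sin \<theta> * sin \<theta> + cos \<theta> * cos \<theta> = 1"
    using sin_cos_squared_add[of \<theta>] by (simp_all add: power2_eq_square)
  note m = mult_rotation_index[OF rotation_carrier rc(1), where \<theta> = \<theta>]
  show "(rotation N (- \<theta>) * rotation N \<theta>) $$ (r, c) = 1\<^sub>m (2 * N + 3) $$ (r, c)"
    using rc(2)
  proof (cases c rule: moment_index_cases)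
    case 1
    then show ?thesis
      unfolding 1 m(1) using rc by (auto simp: rotation_index)
  next
    case (2 i)
    then show ?thesis
      unfolding 2(2) m(2)[OF 2(1)] using rc cs by (auto simp: rotation_index)
  next
    case (3 i)
    then show ?thesis
      unfolding 3(2) m(3)[OF 3(1)] using rc cs by (auto simp: rotation_index)
  qed
qed (use rotation_carrier[of N] in auto)

text \<open>An explicit two-sided inverse makes A a unit of the matrix ring, which excludes
  \<open>None\<close>; uniqueness of inverses then identifies the result. This evaluates the term
  \<open>the (mat_inverse ...)\<close> of the theorem.\<close>

lemma mat_inverse_eqI:
  fixes A :: "'a :: field Matrix.mat"
  assumes A: "A \<in> carrier_mat n n" and B: "B \<in> carrier_mat n n"
    and AB: "A * B = 1\<^sub>m n" and BA: "B * A = 1\<^sub>m n"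
  shows "mat_inverse A = Some B"
proof -
  have "A \<in> Units (ring_mat TYPE('a) n ())"
    using A B AB BA by (auto simp: Units_def ring_mat_simps)
  then obtain C where C: "mat_inverse A = Some C"
    using mat_inverse(1)[OF A, of "()"] by (cases "mat_inverse A") auto
  have "C * A = 1\<^sub>m n" "C \<in> carrier_mat n n"
    using mat_inverse(2)[OF A C] by auto
  then have "C = B"
    using assoc_mult_mat[of C n n A n B n] A B AB by simp
  with C show ?thesis
    by simp
qed

lemma mat_inverse_rotation: "mat_inverse (rotation N \<theta>) = Some (rotation N (- \<theta>))"
  using rotation_inverse[of N \<theta>] rotation_inverse[of N "- \<theta>"]
  by (intro mat_inverse_eqI) (auto intro: rotation_carrier)


section \<open>Directional derivatives that are linear in the direction\<close>

text \<open>Linearity in the direction is all that the chain rule with a linear inner map needs.\<close>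

definition gateaux_differentiable :: "nat \<Rightarrow> (real Matrix.vec \<Rightarrow> real) \<Rightarrow> real Matrix.vec \<Rightarrow> bool" where
  "gateaux_differentiable n f V \<longleftrightarrow> (\<exists>l :: nat \<Rightarrow> real. \<forall>d \<in> carrier_vec n.
     ((\<lambda>t. f (V + t \<cdot>\<^sub>v d)) has_field_derivative (\<Sum>c<n. l c * d $ c)) (at 0))"

lemma gateaux_differentiableI:
  assumes "\<And>d. d \<in> carrier_vec n \<Longrightarrow>
    ((\<lambda>t. f (V + t \<cdot>\<^sub>v d)) has_field_derivative (\<Sum>c<n. l c * d $ c)) (at 0)"
  shows "gateaux_differentiable n f V"
  using assms by (auto simp: gateaux_differentiable_def)

lemma gateaux_differentiable_const: "gateaux_differentiable n (\<lambda>U. a) V"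
  by (rule gateaux_differentiableI[where l = "\<lambda>_. 0"]) simp

lemma gateaux_differentiable_index:
  assumes "V \<in> carrier_vec n" "i < n"
  shows "gateaux_differentiable n (\<lambda>U. U $ i) V"
proof (rule gateaux_differentiableI[where l = "\<lambda>c. if c = i then 1 else 0"])
  fix d :: "real Matrix.vec"
  assume d: "d \<in> carrier_vec n"
  have "(\<lambda>t. (V + t \<cdot>\<^sub>v d) $ i) = (\<lambda>t. V $ i + t * d $ i)"
    using assms d by auto
  moreover have "(\<Sum>c<n. (if c = i then 1 else 0) * d $ c) = d $ i"
    using assms by (simp add: if_distrib[of "\<lambda>x. x * _"] cong: if_cong)
  ultimately show "((\<lambda>t. (V + t \<cdot>\<^sub>v d) $ i) has_field_derivative
      (\<Sum>c<n. (if c = i then 1 else 0) * d $ c)) (at 0)"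
    by (auto intro!: derivative_eq_intros)
qed

lemma gateaux_differentiable_add:
  assumes "gateaux_differentiable n f V" "gateaux_differentiable n g V"
  shows "gateaux_differentiable n (\<lambda>U. f U + g U) V"
proof -
  obtain l k where
    l: "\<And>d. d \<in> carrier_vec n \<Longrightarrow>
      ((\<lambda>t. f (V + t \<cdot>\<^sub>v d)) has_field_derivative (\<Sum>c<n. l c * d $ c)) (at 0)" and
    k: "\<And>d. d \<in> carrier_vec n \<Longrightarrow>
      ((\<lambda>t. g (V + t \<cdot>\<^sub>v d)) has_field_derivative (\<Sum>c<n. k c * d $ c)) (at 0)"
    using assms unfolding gateaux_differentiable_def by blast
  show ?thesis
    using DERIV_add[OF l k]
    by (intro gateaux_differentiableI[where l = "\<lambda>c. l c + k c"])
       (simp add: distrib_right sum.distrib)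
qed

text \<open>The product and inverse rules produce function values at t = 0, that is at
  \<open>V + 0 \<cdot>\<^sub>v d\<close>.\<close>

lemma zero_smult_vec_add:
  fixes V :: "real Matrix.vec"
  assumes "V \<in> carrier_vec n" "d \<in> carrier_vec n"
  shows "V + 0 \<cdot>\<^sub>v d = V"
  using assms by (intro eq_vecI) auto

lemma gateaux_differentiable_mult:
  assumes V: "V \<in> carrier_vec n"
    and "gateaux_differentiable n f V" "gateaux_differentiable n g V"
  shows "gateaux_differentiable n (\<lambda>U. f U * g U) V"
proof -
  obtain l k where
    l: "\<And>d. d \<in> carrier_vec n \<Longrightarrow>
      ((\<lambda>t. f (V + t \<cdot>\<^sub>v d)) has_field_derivative (\<Sum>c<n. l c * d $ c)) (at 0)" and
    k: "\<And>d. d \<in> carrier_vec n \<Longrightarrow>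
      ((\<lambda>t. g (V + t \<cdot>\<^sub>v d)) has_field_derivative (\<Sum>c<n. k c * d $ c)) (at 0)"
    using assms unfolding gateaux_differentiable_def by blast
  show ?thesis
  proof (rule gateaux_differentiableI[where l = "\<lambda>c. l c * g V + k c * f V"])
    fix d :: "real Matrix.vec"
    assume d: "d \<in> carrier_vec n"
    show "((\<lambda>t. f (V + t \<cdot>\<^sub>v d) * g (V + t \<cdot>\<^sub>v d)) has_field_derivative
        (\<Sum>c<n. (l c * g V + k c * f V) * d $ c)) (at 0)"
    proof -
      have "(\<Sum>c<n. (l c * g V + k c * f V) * d $ c) = (\<Sum>c<n. l c * d $ c) * g V + (\<Sum>c<n. k c * d $ c) * f V"
        unfolding sum_distrib_right sum.distrib[symmetric] by (intro sum.cong) (simp_all add: algebra_simps)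
      then show ?thesis
        using DERIV_mult[OF l[OF d] k[OF d]] by (simp add: zero_smult_vec_add[OF V d])
    qed
  qed
qed

lemma gateaux_differentiable_inverse:
  assumes V: "V \<in> carrier_vec n" and "gateaux_differentiable n f V" and "f V \<noteq> 0"
  shows "gateaux_differentiable n (\<lambda>U. inverse (f U)) V"
proof -
  obtain l where
    l: "\<And>d. d \<in> carrier_vec n \<Longrightarrow>
      ((\<lambda>t. f (V + t \<cdot>\<^sub>v d)) has_field_derivative (\<Sum>c<n. l c * d $ c)) (at 0)"
    using assms unfolding gateaux_differentiable_def by blast
  show ?thesis
    using DERIV_inverse_fun[OF l] assms(3)
    by (intro gateaux_differentiableI[where l = "\<lambda>c. - (inverse (f V) * l c * inverse (f V))"])
       (simp add: sum_distrib_right sum_distrib_left sum_negf zero_smult_vec_add[OF V] ac_simps)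
qed

lemma gateaux_differentiable_divide:
  assumes "V \<in> carrier_vec n" "gateaux_differentiable n f V" "gateaux_differentiable n g V" "g V \<noteq> 0"
  shows "gateaux_differentiable n (\<lambda>U. f U / g U) V"
  unfolding divide_inverse
  by (intro gateaux_differentiable_mult gateaux_differentiable_inverse assms)

lemma gateaux_differentiable_sum:
  assumes "\<And>j. j \<in> S \<Longrightarrow> gateaux_differentiable n (\<lambda>U. f j U) V"
  shows "gateaux_differentiable n (\<lambda>U. \<Sum>j\<in>S. f j U) V"
  using assms
  by (induction S rule: infinite_finite_induct)
     (auto intro: gateaux_differentiable_const gateaux_differentiable_add)

text \<open>\<open>jacobian\<close> records partial derivatives only. When the directional
  derivative is linear in d, its values on unit vectors are its coefficients, so the Jacobian yields
  the derivative in every direction.\<close>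

lemma has_derivative_jacobian_mult_vec:
  assumes V: "V \<in> carrier_vec n" and r: "r < dim_vec (f V)"
    and f: "gateaux_differentiable n (\<lambda>U. f U $ r) V" and d: "d \<in> carrier_vec n"
  shows "((\<lambda>t. f (V + t \<cdot>\<^sub>v d) $ r) has_field_derivative (jacobian f V *\<^sub>v d) $ r) (at 0)"
proof -
  obtain l where l: "\<And>d. d \<in> carrier_vec n \<Longrightarrow>
      ((\<lambda>t. f (V + t \<cdot>\<^sub>v d) $ r) has_field_derivative (\<Sum>c<n. l c * d $ c)) (at 0)"
    using f unfolding gateaux_differentiable_def by blast
  have "jacobian f V $$ (r, c) = l c" if c: "c < n" for c
  proof -
    have "jacobian f V $$ (r, c) = (\<Sum>b<n. l b * unit_vec n c $ b)"
      using V r c DERIV_imp_deriv[OF l[of "unit_vec n c"]] by (simp add: jacobian_def)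
    also have "\<dots> = (\<Sum>b<n. if b = c then l c else 0)"
      using c by (intro sum.cong) auto
    finally show ?thesis
      using c by simp
  qed
  then have "(jacobian f V *\<^sub>v d) $ r = (\<Sum>c<n. l c * d $ c)"
    using V r d
    by (auto simp: scalar_prod_def atLeast0LessThan jacobian_def intro!: sum.cong)
  then show ?thesis
    using l[OF d] by simp
qed

lemma dim_jacobian:
  "dim_row (jacobian f U) = dim_vec (f U)" "dim_col (jacobian f U) = dim_vec U"
  by (simp_all add: jacobian_def)


section \<open>Rotation of the fluxes\<close>

lemma dim_flux: "dim_vec (flux_F N g U) = 2 * N + 3" "dim_vec (flux_G N g U) = 2 * N + 3"
  by (simp_all add: flux_F_def flux_G_def moment_vec_def Let_def)

lemma flux_carrier: "flux_F N g U \<in> carrier_vec (2 * N + 3)" "flux_G N g U \<in> carrier_vec (2 * N + 3)"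
  by (intro carrier_vecI dim_flux)+

lemma gateaux_differentiable_primitive:
  assumes "V \<in> carrier_vec (2 * N + 3)" "height V \<noteq> 0"
  shows "gateaux_differentiable (2 * N + 3) height V"
    and "gateaux_differentiable (2 * N + 3) u_mean V"
    and "gateaux_differentiable (2 * N + 3) v_mean V"
    and "i \<le> N \<Longrightarrow> gateaux_differentiable (2 * N + 3) (\<lambda>U. alpha U i) V"
    and "i \<le> N \<Longrightarrow> gateaux_differentiable (2 * N + 3) (\<lambda>U. beta U i) V"
proof -
  show h: "gateaux_differentiable (2 * N + 3) height V"
    unfolding height_def[abs_def] by (intro gateaux_differentiable_index assms) simp
  note divide = gateaux_differentiable_divide[OF assms(1) gateaux_differentiable_index[OF assms(1)] h assms(2)]
  show "gateaux_differentiable (2 * N + 3) u_mean V"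
    unfolding u_mean_def[abs_def] by (intro divide) simp
  show "gateaux_differentiable (2 * N + 3) v_mean V"
    unfolding v_mean_def[abs_def] by (intro divide) simp
  assume "i \<le> N"
  then show "gateaux_differentiable (2 * N + 3) (\<lambda>U. alpha U i) V"
    unfolding alpha_def[abs_def] by (intro divide) simp
  show "gateaux_differentiable (2 * N + 3) (\<lambda>U. beta U i) V"
    unfolding beta_def[abs_def] using \<open>i \<le> N\<close> by (intro divide) simp
qed

lemma jacobian_flux_carrier:
  assumes "U \<in> carrier_vec n"
  shows "jacobian (flux_F N g) U \<in> carrier_mat (2 * N + 3) n"
    and "jacobian (flux_G N g) U \<in> carrier_mat (2 * N + 3) n"
  using assms by (intro carrier_matI; simp add: dim_jacobian dim_flux)+

lemma gateaux_differentiable_moment_vec: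
  assumes "gateaux_differentiable n a V" "gateaux_differentiable n b V" "gateaux_differentiable n c V"
    and "\<And>i. i \<le> N \<Longrightarrow> gateaux_differentiable n (\<lambda>U. p U i) V"
    and "\<And>i. i \<le> N \<Longrightarrow> gateaux_differentiable n (\<lambda>U. q U i) V"
    and "r < 2 * N + 3"
  shows "gateaux_differentiable n (\<lambda>U. moment_vec N (a U) (b U) (c U) (p U) (q U) $ r) V"
proof -
  \<comment> \<open>The block number stays in the range where the hypotheses on p and q
    hold.\<close>
  have "(r - 1) div 2 \<le> N"
    using assms(6) by linarith
  then show ?thesis
    using assms by (cases "r = 0"; cases "r = 1"; cases "r = 2"; cases "odd r") (simp_all add: moment_vec_def)
qed

lemma gateaux_differentiable_flux:
  assumes V: "V \<in> carrier_vec (2 * N + 3)" "height V \<noteq> 0" and r: "r < 2 * N + 3"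
  shows "gateaux_differentiable (2 * N + 3) (\<lambda>U. flux_F N g U $ r) V"
    and "gateaux_differentiable (2 * N + 3) (\<lambda>U. flux_G N g U $ r) V"
proof -
  have "2 * real j + 1 \<noteq> 0" for j
    using of_nat_0_le_iff[of j, where ?'a = real] by linarith
  \<comment> \<open>The fluxes are rational in the primitive variables, so these rules follow their
    syntax; \<open>this\<close> handles the denominators 2 j + 1.\<close>
  note intros = gateaux_differentiable_moment_vec[OF _ _ _ _ _ r] this
    gateaux_differentiable_const gateaux_differentiable_add
    gateaux_differentiable_mult[OF V(1)] gateaux_differentiable_divide[OF V(1)] gateaux_differentiable_sum
    gateaux_differentiable_primitive[OF V]
  show "gateaux_differentiable (2 * N + 3) (\<lambda>U. flux_F N g U $ r) V"
    unfolding flux_F_def Let_def power2_eq_square by (intro intros) simp_all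
  show "gateaux_differentiable (2 * N + 3) (\<lambda>U. flux_G N g U $ r) V"
    unfolding flux_G_def Let_def power2_eq_square by (intro intros) simp_all
qed

text \<open>T fixes the height, so dividing by it preserves the linear action. The mean velocity is
  the case of block 0.\<close>

lemma primitive_rotation:
  assumes "U \<in> carrier_vec (2 * N + 3)"
  shows "height (rotation N \<theta> *\<^sub>v U) = height U"
    and "u_mean (rotation N \<theta> *\<^sub>v U) = cos \<theta> * u_mean U + sin \<theta> * v_mean U"
    and "v_mean (rotation N \<theta> *\<^sub>v U) = - sin \<theta> * u_mean U + cos \<theta> * v_mean U"
    and "i \<le> N \<Longrightarrow> alpha (rotation N \<theta> *\<^sub>v U) i = cos \<theta> * alpha U i + sin \<theta> * beta U i"
    and "i \<le> N \<Longrightarrow> beta (rotation N \<theta> *\<^sub>v U) i = - sin \<theta> * alpha U i + cos \<theta> * beta U i"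
proof -
  note m = rotation_mult_vec_index[OF assms, where \<theta> = \<theta>]
  show h: "height (rotation N \<theta> *\<^sub>v U) = height U"
    by (simp add: height_def m)
  show "u_mean (rotation N \<theta> *\<^sub>v U) = cos \<theta> * u_mean U + sin \<theta> * v_mean U"
    using m(2)[of 0] by (simp add: u_mean_def v_mean_def h add_divide_distrib numeral_2_eq_2)
  show "v_mean (rotation N \<theta> *\<^sub>v U) = - sin \<theta> * u_mean U + cos \<theta> * v_mean U"
    using m(3)[of 0] by (simp add: u_mean_def v_mean_def h diff_divide_distrib numeral_2_eq_2)
  assume i: "i \<le> N"
  show "alpha (rotation N \<theta> *\<^sub>v U) i = cos \<theta> * alpha U i + sin \<theta> * beta U i"
    using m(2)[OF i] by (simp add: alpha_def beta_def h add_divide_distrib)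
  show "beta (rotation N \<theta> *\<^sub>v U) i = - sin \<theta> * alpha U i + cos \<theta> * beta U i"
    using m(3)[OF i] by (simp add: alpha_def beta_def h diff_divide_distrib)
qed

lemma A_coeff_commute: "A_coeff i j k = A_coeff i k j"
  by (simp add: A_coeff_def mult.assoc mult.left_commute mult.commute)

text \<open>Swapping the two summations turns the exchange of a and b into an exchange of j and
  k.\<close>

lemma A_coeff_sum_commute:
  "(\<Sum>j=1..N. \<Sum>k=1..N. A_coeff i j k * a j * b k) = (\<Sum>j=1..N. \<Sum>k=1..N. A_coeff i j k * b j * a k)"
  by (subst sum.swap) (intro sum.cong refl, subst A_coeff_commute, simp)

text \<open>In vector notation \<open>w = (u, v)\<close>, \<open>a\<^sub>i = (\<alpha>\<^sub>i, \<beta>\<^sub>i)\<close>, \<open>n = (cos \<theta>, sin \<theta>)\<close>, the \<open>i\<close>-th block of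
  \<open>cos \<theta> F + sin \<theta> G\<close> is \<open>h ((n w) a\<^sub>i + (n a\<^sub>i) w + \<Sum>\<^sub>j\<^sub>k A\<^sub>i\<^sub>j\<^sub>k (n a\<^sub>j) a\<^sub>k)\<close>, which is manifestly
  covariant; the symmetry \<open>A\<^sub>i\<^sub>j\<^sub>k = A\<^sub>i\<^sub>k\<^sub>j\<close> puts the cross terms into this form.\<close>

lemma flux_rotation:
  assumes U: "U \<in> carrier_vec (2 * N + 3)"
  shows "rotation N \<theta> *\<^sub>v (cos \<theta> \<cdot>\<^sub>v flux_F N g U + sin \<theta> \<cdot>\<^sub>v flux_G N g U) =
    flux_F N g (rotation N \<theta> *\<^sub>v U)"
proof (rule eq_vecI)
  fix r
  assume "r < dim_vec (flux_F N g (rotation N \<theta> *\<^sub>v U))"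
  then have r: "r < 2 * N + 3"
    by (simp add: dim_flux)
  let ?W = "rotation N \<theta> *\<^sub>v U"
  define s where "s = sin \<theta>"
  define c where "c = cos \<theta>"
  \<comment> \<open>To be applied to the pressure term.\<close>
  have sc: "c\<^sup>2 * x + s\<^sup>2 * x = x" for x
    by (simp add: s_def c_def flip: distrib_right)
  \<comment> \<open>Treating the sums as bilinear forms q and Q reduces each component to a
    polynomial identity in their values at the old moments.\<close>
  define q where "q a b = (\<Sum>j=1..N. a j * b j / (2 * real j + 1))" for a b :: "nat \<Rightarrow> real"
  define Q where "Q i a b = (\<Sum>j=1..N. \<Sum>k=1..N. A_coeff i j k * a j * b k)" for i a b
  have q_lin: "q (\<lambda>j. x * a j + y * b j) d = x * q a d + y * q b d"
    and q_lin': "q d (\<lambda>j. x * a j + y * b j) = x * q d a + y * q d b" for x y a b d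
    by (simp_all add: q_def sum_distrib_left sum.distrib[symmetric] add_divide_distrib algebra_simps)
  have q_commute: "q a b = q b a" for a b
    by (simp add: q_def mult.commute)
  have Q_lin: "Q i (\<lambda>j. x * a j + y * b j) d = x * Q i a d + y * Q i b d"
    and Q_lin': "Q i d (\<lambda>j. x * a j + y * b j) = x * Q i d a + y * Q i d b" for i x y a b d
    by (simp_all add: Q_def sum_distrib_left sum.distrib[symmetric] algebra_simps)
  have Q_commute: "Q i a b = Q i b a" for i a b
    unfolding Q_def by (rule A_coeff_sum_commute)
  define \<alpha> where "\<alpha> = (\<lambda>i. c * alpha U i + s * beta U i)"
  define \<beta> where "\<beta> = (\<lambda>i. (- s) * alpha U i + c * beta U i)"
  \<comment> \<open>Instances at the fixed rotated sequences, folded so that they rewrite constants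
    instead of matching arbitrary functions.\<close>
  note bilin = q_lin[of c "alpha U" s "beta U", folded \<alpha>_def] q_lin'[of _ c "alpha U" s "beta U", folded \<alpha>_def]
    q_lin'[of _ "- s" "alpha U" c "beta U", folded \<beta>_def]
    Q_lin[of _ c "alpha U" s "beta U", folded \<alpha>_def] Q_lin'[of _ _ c "alpha U" s "beta U", folded \<alpha>_def]
    Q_lin'[of _ _ "- s" "alpha U" c "beta U", folded \<beta>_def]
  note prim = primitive_rotation[OF U, where \<theta> = \<theta>, folded c_def s_def]
  \<comment> \<open>The rotated moments are known for indices up to N only, so they are replaced
    under the sums and not as functions.\<close>
  have q_W: "q (alpha ?W) (alpha ?W) = q \<alpha> \<alpha>" "q (alpha ?W) (beta ?W) = q \<alpha> \<beta>"
    and Q_W: "Q i (alpha ?W) (alpha ?W) = Q i \<alpha> \<alpha>" "Q i (alpha ?W) (beta ?W) = Q i \<alpha> \<beta>" for i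
    unfolding q_def Q_def \<alpha>_def \<beta>_def by (intro sum.cong refl; simp add: prim)+
  have F: "flux_F N g U = moment_vec N (height U * u_mean U)
      (height U * ((u_mean U)\<^sup>2 + q (alpha U) (alpha U)) + 1/2 * g * (height U)\<^sup>2)
      (height U * (u_mean U * v_mean U + q (alpha U) (beta U)))
      (\<lambda>i. height U * (2 * u_mean U * alpha U i + Q i (alpha U) (alpha U)))
      (\<lambda>i. height U * (u_mean U * beta U i + v_mean U * alpha U i + Q i (alpha U) (beta U)))" for U
    by (simp add: flux_F_def Let_def q_def Q_def power2_eq_square)
  have G: "flux_G N g U = moment_vec N (height U * v_mean U)
      (height U * (u_mean U * v_mean U + q (alpha U) (beta U)))
      (height U * ((v_mean U)\<^sup>2 + q (beta U) (beta U)) + 1/2 * g * (height U)\<^sup>2)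
      (\<lambda>i. height U * (u_mean U * beta U i + v_mean U * alpha U i + Q i (alpha U) (beta U)))
      (\<lambda>i. height U * (2 * v_mean U * beta U i + Q i (beta U) (beta U)))" for U
    by (simp add: flux_G_def Let_def q_def Q_def power2_eq_square)
  define X where "X = cos \<theta> \<cdot>\<^sub>v flux_F N g U + sin \<theta> \<cdot>\<^sub>v flux_G N g U"
  have X: "X \<in> carrier_vec (2 * N + 3)"
    using flux_carrier[of N g U] by (simp add: X_def)
  have X_index: "X $ r = c * flux_F N g U $ r + s * flux_G N g U $ r" if "r < 2 * N + 3" for r
    using that by (simp add: X_def dim_flux c_def s_def)
  note m = rotation_mult_vec_index[OF X, where \<theta> = \<theta>, folded c_def s_def]
  note lin = q_W Q_W bilin
    q_commute[of "beta U" "alpha U"] Q_commute[of _ "beta U" "alpha U"]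
  have "(rotation N \<theta> *\<^sub>v X) $ r = flux_F N g ?W $ r"
    using r
  proof (cases r rule: moment_index_cases)
    case 1
    show ?thesis
      unfolding 1 m(1) by (simp add: X_index F G moment_vec_index prim algebra_simps)
  next
    case (2 i)
    show ?thesis
    proof (cases "i = 0")
      case True
      have "(rotation N \<theta> *\<^sub>v X) $ 1 = c * X $ 1 + s * X $ 2"
        using m(2)[of 0] by (simp add: numeral_2_eq_2)
      also have "\<dots> = flux_F N g ?W $ 1"
        \<comment> \<open>The pressure enters once through F and once through G, with total factor
          c^2 + s^2.\<close>
        using sc[of "g * (height U)\<^sup>2 / 2"]
        by (simp add: X_index F G moment_vec_index[unfolded One_nat_def] prim lin)
           (simp add: algebra_simps power2_eq_square)
      finally show ?thesis
        using 2 True by simp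
    next
      case False
      then have i: "1 \<le> i" "i \<le> N"
        using 2 by auto
      show ?thesis
        unfolding 2(2) m(2)[OF i(2)] using i
        by (simp add: X_index F G moment_vec_index(4,5)[simplified] prim lin)
           (simp add: algebra_simps power2_eq_square)
    qed
  next
    case (3 i)
    show ?thesis
    proof (cases "i = 0")
      case True
      have "(rotation N \<theta> *\<^sub>v X) $ 2 = - s * X $ 1 + c * X $ 2"
        using m(3)[of 0] by (simp add: numeral_2_eq_2)
      also have "\<dots> = flux_F N g ?W $ 2"
        \<comment> \<open>In this component the two pressure contributions cancel, with factors - s
          c and c s.\<close>
        by (simp add: X_index F G moment_vec_index[unfolded One_nat_def] prim lin)
           (simp add: algebra_simps power2_eq_square)
      finally show ?thesis
        using 3 True by (simp add: numeral_2_eq_2)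
    next
      case False
      then have i: "1 \<le> i" "i \<le> N"
        using 3 by auto
      show ?thesis
        unfolding 3(2) m(3)[OF i(2)] using i
        by (simp add: X_index F G moment_vec_index(4,5)[simplified] prim lin)
           (simp add: algebra_simps power2_eq_square)
    qed
  qed
  then show "(rotation N \<theta> *\<^sub>v (cos \<theta> \<cdot>\<^sub>v flux_F N g U + sin \<theta> \<cdot>\<^sub>v flux_G N g U)) $ r = flux_F N g ?W $ r"
    by (simp only: X_def)
qed (use rotation_carrier[of N \<theta>] in \<open>simp add: dim_flux\<close>)


section \<open>Rotation of the coefficient matrices\<close>

lemma eq_mat_if_mult_vec_eq:
  fixes A B :: "'a :: semiring_1 Matrix.mat"
  assumes "A \<in> carrier_mat n m" "B \<in> carrier_mat n m"
    and "\<And>d. d \<in> carrier_vec m \<Longrightarrow> A *\<^sub>v d = B *\<^sub>v d"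
  shows "A = B"
proof (rule eq_matI)
  fix r c
  assume rc: "r < dim_row B" "c < dim_col B"
  then have "(A *\<^sub>v unit_vec m c) $ r = (B *\<^sub>v unit_vec m c) $ r"
    using assms by simp
  then show "A $$ (r, c) = B $$ (r, c)"
    using assms(1,2) rc by auto
qed (use assms in auto)

text \<open>Applied to a direction d, both sides are the derivative at t = 0 of the flux identity
  along U + t d. The factor T on the right comes from the chain rule.\<close>

lemma jacobian_rotation:
  assumes U: "U \<in> carrier_vec (2 * N + 3)" and h: "height U \<noteq> 0"
  shows "rotation N \<theta> * (cos \<theta> \<cdot>\<^sub>m jacobian (flux_F N g) U + sin \<theta> \<cdot>\<^sub>m jacobian (flux_G N g) U) =
    jacobian (flux_F N g) (rotation N \<theta> *\<^sub>v U) * rotation N \<theta>"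
    (is "?T * (_ \<cdot>\<^sub>m ?F + _ \<cdot>\<^sub>m ?G) = ?F' * _")
proof (rule eq_mat_if_mult_vec_eq)
  let ?n = "2 * N + 3"
  note T = rotation_carrier[of N \<theta>]
  have F: "?F \<in> carrier_mat ?n ?n" and G: "?G \<in> carrier_mat ?n ?n" and F': "?F' \<in> carrier_mat ?n ?n"
    using U mult_mat_vec_carrier[OF T U] by (auto intro!: jacobian_flux_carrier)
  show "?T * (cos \<theta> \<cdot>\<^sub>m ?F + sin \<theta> \<cdot>\<^sub>m ?G) \<in> carrier_mat ?n ?n" "?F' * ?T \<in> carrier_mat ?n ?n"
    using T F G F' by auto
  fix d :: "real Matrix.vec"
  assume d: "d \<in> carrier_vec ?n"
  have TU: "?T *\<^sub>v U \<in> carrier_vec ?n" and Td: "?T *\<^sub>v d \<in> carrier_vec ?n"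
    using T U d by auto
  have h': "height (?T *\<^sub>v U) \<noteq> 0"
    using h by (simp add: primitive_rotation[OF U])
  let ?X = "\<lambda>t. cos \<theta> \<cdot>\<^sub>v flux_F N g (U + t \<cdot>\<^sub>v d) + sin \<theta> \<cdot>\<^sub>v flux_G N g (U + t \<cdot>\<^sub>v d)"
  let ?x = "cos \<theta> \<cdot>\<^sub>v (?F *\<^sub>v d) + sin \<theta> \<cdot>\<^sub>v (?G *\<^sub>v d)"
  have X: "?X t \<in> carrier_vec ?n" for t
    using flux_carrier[of N g] by simp
  have x: "?x \<in> carrier_vec ?n"
    using F G d by simp
  have X_index: "((\<lambda>t. ?X t $ c) has_field_derivative ?x $ c) (at 0)" if c: "c < ?n" for c
  proof -
    note D = has_derivative_jacobian_mult_vec[where f = "flux_F N g", unfolded dim_flux, OF U c gateaux_differentiable_flux(1)[OF U h c] d]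
      has_derivative_jacobian_mult_vec[where f = "flux_G N g", unfolded dim_flux, OF U c gateaux_differentiable_flux(2)[OF U h c] d]
    show ?thesis
      using DERIV_add[OF DERIV_cmult[OF D(1), of "cos \<theta>"] DERIV_cmult[OF D(2), of "sin \<theta>"]] F G c
      by (simp add: dim_flux)
  qed
  \<comment> \<open>T maps the line through U with direction d to the line through T U with
    direction T d.\<close>
  have TX: "?T *\<^sub>v ?X t = flux_F N g (?T *\<^sub>v U + t \<cdot>\<^sub>v (?T *\<^sub>v d))" for t
  proof -
    have "?T *\<^sub>v (U + t \<cdot>\<^sub>v d) = ?T *\<^sub>v U + t \<cdot>\<^sub>v (?T *\<^sub>v d)"
      using T U d by (simp add: mult_add_distrib_mat_vec mult_mat_vec)
    then show ?thesis
      using U d by (subst flux_rotation) auto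
  qed
  have expand: "(?T *\<^sub>v y) $ r = (\<Sum>c<?n. ?T $$ (r, c) * y $ c)" if "r < ?n" "y \<in> carrier_vec ?n" for r y
    using that T by (auto simp: scalar_prod_def atLeast0LessThan intro!: sum.cong)
  have Tx: "?T *\<^sub>v ?x = ?F' *\<^sub>v (?T *\<^sub>v d)"
  proof (rule eq_vecI)
    fix r
    assume "r < dim_vec (?F' *\<^sub>v (?T *\<^sub>v d))"
    then have r: "r < ?n"
      using F' by simp
    \<comment> \<open>The same function of t is differentiated twice: as a fixed linear combination
      of the components of \<open>?X\<close>, then as the flux F along the rotated line.\<close>
    have "((\<lambda>t. (?T *\<^sub>v ?X t) $ r) has_field_derivative (?T *\<^sub>v ?x) $ r) (at 0)"
      unfolding expand[OF r X] expand[OF r x] by (intro DERIV_sum DERIV_cmult X_index) simp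
    moreover have "((\<lambda>t. (?T *\<^sub>v ?X t) $ r) has_field_derivative (?F' *\<^sub>v (?T *\<^sub>v d)) $ r) (at 0)"
      unfolding TX
      by (rule has_derivative_jacobian_mult_vec[OF TU _ gateaux_differentiable_flux(1)[OF TU h' r] Td])
         (use r in \<open>simp add: dim_flux\<close>)
    ultimately show "(?T *\<^sub>v ?x) $ r = (?F' *\<^sub>v (?T *\<^sub>v d)) $ r"
      by (rule DERIV_unique)
  qed (use T F' in simp)
  have smult: "(a \<cdot>\<^sub>m M) *\<^sub>v d = a \<cdot>\<^sub>v (M *\<^sub>v d)" if "M \<in> carrier_mat ?n ?n" for a and M :: "real Matrix.mat"
    using that d by (intro eq_vecI) auto
  have "(cos \<theta> \<cdot>\<^sub>m ?F + sin \<theta> \<cdot>\<^sub>m ?G) *\<^sub>v d = ?x"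
    using F G d by (subst add_mult_distrib_mat_vec[of _ ?n ?n]) (auto simp: smult)
  then show "(?T * (cos \<theta> \<cdot>\<^sub>m ?F + sin \<theta> \<cdot>\<^sub>m ?G)) *\<^sub>v d = (?F' * ?T) *\<^sub>v d"
    using T F G F' d Tx by (subst (1 2) assoc_mult_mat_vec[of _ ?n ?n _ ?n]) auto
qed

section \<open>Rotation of the non-conservative parts\<close>

lemma noncons_carrier:
  "noncons_P N U \<in> carrier_mat (2 * N + 3) (2 * N + 3)"
  "noncons_Q N U \<in> carrier_mat (2 * N + 3) (2 * N + 3)"
  by (simp_all add: noncons_P_def noncons_Q_def)

text \<open>\<open>noncons_u\<close> and \<open>noncons_v\<close> are the upper and lower entries of
  the nonzero column that the blocks of P and Q share. Their value 0 for i = 0 or j = 0 lets the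
  momentum entries count as block 0.\<close>

definition noncons_u :: "nat \<Rightarrow> real Matrix.vec \<Rightarrow> nat \<Rightarrow> nat \<Rightarrow> real" where
  "noncons_u N U i j = (if i = 0 \<or> j = 0 then 0
     else - (if i = j then 1 else 0) * u_mean U + (\<Sum>k=1..N. B_coeff i j k * alpha U k))"

definition noncons_v :: "nat \<Rightarrow> real Matrix.vec \<Rightarrow> nat \<Rightarrow> nat \<Rightarrow> real" where
  "noncons_v N U i j = (if i = 0 \<or> j = 0 then 0
     else - (if i = j then 1 else 0) * v_mean U + (\<Sum>k=1..N. B_coeff i j k * beta U k))"

lemma noncons_P_index:
  "c < 2 * N + 3 \<Longrightarrow> noncons_P N U $$ (0, c) = 0"
  "r < 2 * N + 3 \<Longrightarrow> noncons_P N U $$ (r, 0) = 0"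
  "i \<le> N \<Longrightarrow> j \<le> N \<Longrightarrow> noncons_P N U $$ (2 * i + 1, 2 * j + 1) = noncons_u N U i j"
  "i \<le> N \<Longrightarrow> j \<le> N \<Longrightarrow> noncons_P N U $$ (2 * i + 2, 2 * j + 1) = noncons_v N U i j"
  "r < 2 * N + 3 \<Longrightarrow> j \<le> N \<Longrightarrow> noncons_P N U $$ (r, 2 * j + 2) = 0"
  by (auto simp: noncons_P_def noncons_u_def noncons_v_def Let_def)

lemma noncons_Q_index:
  "c < 2 * N + 3 \<Longrightarrow> noncons_Q N U $$ (0, c) = 0"
  "r < 2 * N + 3 \<Longrightarrow> noncons_Q N U $$ (r, 0) = 0"
  "i \<le> N \<Longrightarrow> j \<le> N \<Longrightarrow> noncons_Q N U $$ (2 * i + 1, 2 * j + 2) = noncons_u N U i j"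
  "i \<le> N \<Longrightarrow> j \<le> N \<Longrightarrow> noncons_Q N U $$ (2 * i + 2, 2 * j + 2) = noncons_v N U i j"
  "r < 2 * N + 3 \<Longrightarrow> j \<le> N \<Longrightarrow> noncons_Q N U $$ (r, 2 * j + 1) = 0"
  by (auto simp: noncons_Q_def noncons_u_def noncons_v_def Let_def)

text \<open>Both entries depend linearly, with the same coefficients, on the first and second
  components of planar vectors, so the pair rotates as a planar vector.\<close>

lemma noncons_uv_rotation:
  assumes "U \<in> carrier_vec (2 * N + 3)"
  shows "noncons_u N (rotation N \<theta> *\<^sub>v U) i j = cos \<theta> * noncons_u N U i j + sin \<theta> * noncons_v N U i j"
    and "noncons_v N (rotation N \<theta> *\<^sub>v U) i j = - sin \<theta> * noncons_u N U i j + cos \<theta> * noncons_v N U i j"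
proof -
  have "(\<Sum>k=1..N. B_coeff i j k * alpha (rotation N \<theta> *\<^sub>v U) k) =
      cos \<theta> * (\<Sum>k=1..N. B_coeff i j k * alpha U k) + sin \<theta> * (\<Sum>k=1..N. B_coeff i j k * beta U k)"
    "(\<Sum>k=1..N. B_coeff i j k * beta (rotation N \<theta> *\<^sub>v U) k) =
      - sin \<theta> * (\<Sum>k=1..N. B_coeff i j k * alpha U k) + cos \<theta> * (\<Sum>k=1..N. B_coeff i j k * beta U k)"
    unfolding sum_distrib_left sum.distrib[symmetric]
    by (intro sum.cong refl; simp add: primitive_rotation[OF assms] algebra_simps)+
  then show "noncons_u N (rotation N \<theta> *\<^sub>v U) i j = cos \<theta> * noncons_u N U i j + sin \<theta> * noncons_v N U i j"
    and "noncons_v N (rotation N \<theta> *\<^sub>v U) i j = - sin \<theta> * noncons_u N U i j + cos \<theta> * noncons_v N U i j"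
    by (simp_all add: noncons_u_def noncons_v_def primitive_rotation[OF assms] algebra_simps)
qed

text \<open>The block \<open>(i, j)\<close> of \<open>cos \<theta> P + sin \<theta> Q\<close> is a rotating column vector times the row
  \<open>(cos \<theta>, sin \<theta>)\<close>, and that row is the first row of the rotation matrix.\<close>

lemma noncons_rotation:
  assumes U: "U \<in> carrier_vec (2 * N + 3)"
  shows "rotation N \<theta> * (cos \<theta> \<cdot>\<^sub>m noncons_P N U + sin \<theta> \<cdot>\<^sub>m noncons_Q N U) =
    noncons_P N (rotation N \<theta> *\<^sub>v U) * rotation N \<theta>"
    (is "?T * ?M = ?P' * _")
proof (rule eq_matI)
  let ?n = "2 * N + 3"
  fix r c
  note T = rotation_carrier[of N \<theta>] and PQ = noncons_carrier[of N]
  assume "r < dim_row (?P' * ?T)" "c < dim_col (?P' * ?T)"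
  then have r: "r < ?n" and c: "c < ?n"
    using T PQ(1)[of "?T *\<^sub>v U"] by auto
  have M: "?M \<in> carrier_mat ?n ?n"
    using PQ by simp
  \<comment> \<open>Left multiplication by T is its action on column c, while on the other side T
    mixes the columns of P at the rotated state.\<close>
  define x where "x = col ?M c"
  have x_index: "x $ r = cos \<theta> * noncons_P N U $$ (r, c) + sin \<theta> * noncons_Q N U $$ (r, c)"
    if "r < ?n" for r
    using that c PQ[of U] by (auto simp: x_def)
  have "x \<in> carrier_vec ?n"
    using M c by (auto simp: x_def)
  note m = rotation_mult_vec_index[OF this, where \<theta> = \<theta>]
  note m' = mult_rotation_index[OF PQ(1) r, where \<theta> = \<theta>]
  note noncons_index = noncons_P_index[simplified] noncons_Q_index[simplified]
    noncons_uv_rotation[OF U]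
  have "(?T * ?M) $$ (r, c) = (?T *\<^sub>v x) $ r"
    using T M r c by (auto simp: x_def)
  also have "\<dots> = (?P' * ?T) $$ (r, c)"
    using r
  proof (cases r rule: moment_index_cases)
    case 1
    show ?thesis
      unfolding 1 m(1) using c
      by (cases c rule: moment_index_cases)
        (simp_all add: x_index m'[unfolded 1, simplified] noncons_P_index noncons_Q_index)
  next
    case i: (2 i)
    show ?thesis
      unfolding i(2) m(2)[OF i(1)] using c i(1)
      by (cases c rule: moment_index_cases)
        (simp_all add: x_index m'[unfolded i(2), simplified] noncons_index ring_distribs mult.left_commute add_ac)
  next
    case i: (3 i)
    show ?thesis
      unfolding i(2) m(3)[OF i(1)] using c i(1)
      by (cases c rule: moment_index_cases)
        (simp_all add: x_index m'[unfolded i(2), simplified] noncons_index ring_distribs mult.left_commute add_ac)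
  qed
  finally show "(?T * ?M) $$ (r, c) = (?P' * ?T) $$ (r, c)" .
qed (use rotation_carrier[of N \<theta>] noncons_carrier(1)[of N "rotation N \<theta> *\<^sub>v U"] noncons_carrier(2)[of N U] in auto)

section \<open>The full coefficient matrices and the passage to the first moments\<close>

lemma SWME_rotation:
  assumes U: "U \<in> carrier_vec (2 * N + 3)" and h: "height U \<noteq> 0"
  shows "cos \<theta> \<cdot>\<^sub>m SWME_A N g U + sin \<theta> \<cdot>\<^sub>m SWME_B N g U =
    the (mat_inverse (rotation N \<theta>)) * SWME_A N g (rotation N \<theta> *\<^sub>v U) * rotation N \<theta>"
proof -
  let ?n = "2 * N + 3" and ?T = "rotation N \<theta>"
  note T = rotation_carrier[of N]
  have J: "jacobian (flux_F N g) V \<in> carrier_mat ?n ?n" "jacobian (flux_G N g) V \<in> carrier_mat ?n ?n"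
    if "V \<in> carrier_vec ?n" for V
    using that by (auto intro!: jacobian_flux_carrier)
  note PQ = noncons_carrier[of N]
  let ?J = "cos \<theta> \<cdot>\<^sub>m jacobian (flux_F N g) U + sin \<theta> \<cdot>\<^sub>m jacobian (flux_G N g) U"
  let ?M = "cos \<theta> \<cdot>\<^sub>m noncons_P N U + sin \<theta> \<cdot>\<^sub>m noncons_Q N U"
  have comb: "cos \<theta> \<cdot>\<^sub>m SWME_A N g U + sin \<theta> \<cdot>\<^sub>m SWME_B N g U = ?J + ?M"
    unfolding SWME_A_def SWME_B_def using J[OF U] PQ[of U]
    by (intro eq_matI) (auto simp: algebra_simps)
  \<comment> \<open>Both parts satisfy an intertwining relation free of inverses, so the two
    relations can be added before T is inverted.\<close>
  have rot: "?T * (?J + ?M) = SWME_A N g (?T *\<^sub>v U) * ?T"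
  proof -
    have TU: "?T *\<^sub>v U \<in> carrier_vec ?n"
      using mult_mat_vec_carrier[OF T U] .
    have "?T * (?J + ?M) = ?T * ?J + ?T * ?M"
      using T J[OF U] PQ by (intro mult_add_distrib_mat[of _ ?n ?n _ ?n]) auto
    also have "\<dots> = SWME_A N g (?T *\<^sub>v U) * ?T"
      unfolding SWME_A_def jacobian_rotation[OF U h] noncons_rotation[OF U]
      using T J[OF TU] PQ by (intro add_mult_distrib_mat[of _ ?n ?n _ _ ?n, symmetric]) auto
    finally show ?thesis .
  qed
  have S: "SWME_A N g (?T *\<^sub>v U) \<in> carrier_mat ?n ?n"
    unfolding SWME_A_def by (intro add_carrier_mat PQ)
  have JM: "?J + ?M \<in> carrier_mat ?n ?n"
    using PQ by simp
  have "?J + ?M = rotation N (- \<theta>) * ?T * (?J + ?M)"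
    unfolding rotation_inverse by (rule left_mult_one_mat[OF JM, symmetric])
  also have "\<dots> = rotation N (- \<theta>) * SWME_A N g (?T *\<^sub>v U) * ?T"
    unfolding assoc_mult_mat[OF T T JM] rot by (rule assoc_mult_mat[OF T S T, symmetric])
  finally show ?thesis
    by (simp only: comb mat_inverse_rotation option.sel)
qed

text \<open>The cut at index 5 falls between blocks 1 and 2, and T does not mix different
  blocks.\<close>

lemma first_moment_state_rotation:
  assumes "N \<ge> 1" "U \<in> carrier_vec (2 * N + 3)"
  shows "first_moment_state N (rotation N \<theta> *\<^sub>v U) = rotation N \<theta> *\<^sub>v first_moment_state N U"
proof (rule eq_vecI)
  have V: "first_moment_state N U \<in> carrier_vec (2 * N + 3)"
    by (simp add: first_moment_state_def)
  note m = rotation_mult_vec_index[OF assms(2), where \<theta> = \<theta>] rotation_mult_vec_index[OF V, where \<theta> = \<theta>]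
  fix r
  assume "r < dim_vec (rotation N \<theta> *\<^sub>v first_moment_state N U)"
  then have r: "r < 2 * N + 3"
    using rotation_carrier[of N \<theta>] by simp
  then show "first_moment_state N (rotation N \<theta> *\<^sub>v U) $ r = (rotation N \<theta> *\<^sub>v first_moment_state N U) $ r"
  proof (cases r rule: moment_index_cases)
    case 1
    then show ?thesis
      unfolding 1 m(4) by (simp add: first_moment_state_def m(1))
  next
    case (2 i)
    show ?thesis
      unfolding 2(2) m(5)[OF 2(1)] using r 2 m(2)[OF 2(1)] by (simp add: first_moment_state_def)
  next
    case (3 i)
    show ?thesis
      unfolding 3(2) m(6)[OF 3(1)] using r 3 m(3)[OF 3(1)] by (simp add: first_moment_state_def)
  qed
qed (use rotation_carrier[of N \<theta>] in \<open>simp add: first_moment_state_def\<close>)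

theorem theorem3p2:
  fixes N :: nat and g \<theta> :: real and U :: "real Matrix.vec"
  assumes "N \<ge> 1" and "g > 0"
    and "U \<in> carrier_vec (2 * N + 3)" and "height U > 0"
    and "0 \<le> \<theta>" and "\<theta> < 2 * pi"
  shows "cos \<theta> \<cdot>\<^sub>m HSWME_A N g U + sin \<theta> \<cdot>\<^sub>m HSWME_B N g U
    = the (mat_inverse (rotation N \<theta>)) * HSWME_A N g (rotation N \<theta> *\<^sub>v U) * rotation N \<theta>"
  unfolding HSWME_A_def HSWME_B_def first_moment_state_rotation[OF assms(1,3)]
  \<comment> \<open>The truncation keeps entry 0, so the truncated state still has nonzero
    height.\<close>
  by (rule SWME_rotation) (use assms(4) in \<open>simp_all add: first_moment_state_def height_def\<close>)

end
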